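(* Let $\mathfrak{A}\subset\mathfrak{B}(\mathcal{H})$ be a C*-algebra with unit and $\mathbf{V}$ an isometry on the Hilbert space $\mathcal{H}$ such that $\mathbf{V}^*\mathfrak{A}\mathbf{V}\subset\mathfrak{A}$. Let $(\widehat{\mathbf{V}},\widehat{\mathcal{H}},\mathbf{Z})$ be the minimal unitary dilation of $\mathbf{V}$. Then there exists a C*-algebra with unit $\widehat{\mathfrak{A}}\subset\mathfrak{B}(\widehat{\mathcal{H}})$ such that: 1. $\mathbf{Z}\mathfrak{A}\mathbf{Z}^*\subset\widehat{\mathfrak{A}}$ and $\mathbf{Z}^*\widehat{\mathfrak{A}}\mathbf{Z}\subset\mathfrak{A}$; 2. $\widehat{\mathbf{V}}^*\widehat{\mathfrak{A}}\widehat{\mathbf{V}}\subset\widehat{\mathfrak{A}}$; 3. $\mathbf{Z}^*\widehat{\mathbf{V}}^*X\widehat{\mathbf{V}}\mathbf{Z}=\mathbf{V}^*\mathbf{Z}^*X\mathbf{Z}\mathbf{V}$ for all $X\in\widehat{\mathfrak{A}}$; 4. $\mathbf{Z}^*\widehat{\mathbf{V}}^*(\mathbf{Z}A\mathbf{Z}^* )\widehat{\mathbf{V}}\mathbf{Z}=\mathbf{V}^*A\mathbf{V}$ for all $A\in\mathfrak{A}$.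
   Context: The algebra $\mathfrak{A}$ contains the identity operator of $\mathcal{H}$. The minimal unitary dilation of a linear isometry $\mathbf{V}$ on $\mathcal{H}$ is a triple $(\widehat{\mathbf{V}},\widehat{\mathcal{H}},\mathbf{Z})$ where $\widehat{\mathcal{H}}$ is a Hilbert space, $\mathbf{Z}:\mathcal{H}\to\widehat{\mathcal{H}}$ is a linear isometry and $\widehat{\mathbf{V}}$ is a unitary operator on $\widehat{\mathcal{H}}$ with $\widehat{\mathbf{V}}^n\mathbf{Z}=\mathbf{Z}\mathbf{V}^n$ for all $n\in\mathbb{N}$ and $\widehat{\mathcal{H}}=\bigvee_{k\in\mathbb{Z}}\widehat{\mathbf{V}}^k\mathbf{Z}\mathcal{H}$ (closed linear span). Concretely, with $\mathbf{F}=\mathbf{I}-\mathbf{V}\mathbf{V}^*$, one may take $\widehat{\mathcal{H}}=\mathcal{H}\oplus l^2(\mathbf{F}\mathcal{H})$ (square-summable sequences $\xi:\mathbb{N}\to\mathbf{F}\mathcal{H}$), $\mathbf{Z}\Psi=\Psi\oplus0$ and $\widehat{\mathbf{V}}(\Psi\oplus(\xi_0,\xi_1,\dots))=(\mathbf{V}\Psi+\xi_0)\oplus(\xi_1,\xi_2,\dots)$. *)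

theory Defs
  imports "HOL-Analysis.Analysis"
begin

text \<open>
  Complex Hilbert spaces. The inner product is linear in the second argument, and the norm
  and topology of the underlying real Banach space are those induced by it. Positive
  definiteness follows from \<open>cinner_self\<close>. The zero space is not excluded.
\<close>

class complex_hilbert = banach +
  fixes scaleC :: "complex \<Rightarrow> 'a \<Rightarrow> 'a" (infixr "*\<^sub>C" 75)
    and cinner :: "'a \<Rightarrow> 'a \<Rightarrow> complex"
  assumes scaleC_add_right: "c *\<^sub>C (x + y) = c *\<^sub>C x + c *\<^sub>C y"
    and scaleC_add_left: "(c + d) *\<^sub>C x = c *\<^sub>C x + d *\<^sub>C x"
    and scaleC_scaleC: "c *\<^sub>C d *\<^sub>C x = (c * d) *\<^sub>C x"
    and scaleC_of_real: "complex_of_real r *\<^sub>C x = r *\<^sub>R x"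
    and cinner_commute: "cinner x y = cnj (cinner y x)"
    and cinner_add_right: "cinner x (y + z) = cinner x y + cinner x z"
    and cinner_scaleC_right: "cinner x (c *\<^sub>C y) = c * cinner x y"
    and cinner_self: "cinner x x = complex_of_real ((norm x)\<^sup>2)"

global_interpretation complex_vector:
  vector_space "scaleC :: complex \<Rightarrow> 'a \<Rightarrow> 'a::complex_hilbert"
proof
  show "1 *\<^sub>C x = x" for x :: 'a
    using scaleC_of_real[of 1 x] by simp
qed (simp_all add: scaleC_add_right scaleC_add_left scaleC_scaleC)

lemma norm_scaleC: "norm (c *\<^sub>C x) = cmod c * norm (x :: 'a::complex_hilbert)"
proof -
  have "complex_of_real ((norm (c *\<^sub>C x))\<^sup>2) = cinner (c *\<^sub>C x) (c *\<^sub>C x)"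
    by (simp only: cinner_self)
  also have "\<dots> = c * cnj (cinner x (c *\<^sub>C x))"
    by (simp only: cinner_scaleC_right cinner_commute[of "c *\<^sub>C x" x])
  also have "\<dots> = c * cnj c * cinner x x"
    by (simp add: cinner_scaleC_right cinner_self)
  also have "\<dots> = complex_of_real ((cmod c * norm x)\<^sup>2)"
    by (simp only: cinner_self complex_norm_square[symmetric] power_mult_distrib of_real_mult)
  finally have "(norm (c *\<^sub>C x))\<^sup>2 = (cmod c * norm x)\<^sup>2"
    by (simp only: of_real_eq_iff)
  then show ?thesis
    by (simp add: power2_eq_iff_nonneg)
qed

lemma bounded_linear_scaleC: "bounded_linear (\<lambda>x :: 'a::complex_hilbert. c *\<^sub>C x)"
proof (rule bounded_linear_intro[where K = "cmod c"])
  show "c *\<^sub>C (r *\<^sub>R x) = r *\<^sub>R (c *\<^sub>C x)" for r and x :: 'a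
    by (simp add: scaleC_of_real[symmetric] scaleC_scaleC mult.commute)
qed (simp_all add: scaleC_add_right norm_scaleC mult.commute)


text \<open>
  Bounded operators are the complex-linear elements of the library's type of bounded
  real-linear maps, which carries the operator norm and its topology.
\<close>

definition bounded_ops :: "('a::complex_hilbert \<Rightarrow>\<^sub>L 'b::complex_hilbert) set"
  where "bounded_ops = {T. \<forall>c x. blinfun_apply T (c *\<^sub>C x) = c *\<^sub>C blinfun_apply T x}"

lift_definition scale_op ::
  "complex \<Rightarrow> ('a::complex_hilbert \<Rightarrow>\<^sub>L 'b::complex_hilbert) \<Rightarrow> ('a \<Rightarrow>\<^sub>L 'b)"
  is "\<lambda>c T x. c *\<^sub>C T x"
  by (rule bounded_linear_compose[OF bounded_linear_scaleC])

text \<open>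
  The Hilbert space adjoint. For \<open>T \<in> bounded_ops\<close> existence is the Riesz representation
  theorem; uniqueness is nondegeneracy of the inner product. Only applied to such \<open>T\<close>.
\<close>

definition adj_op :: "('a::complex_hilbert \<Rightarrow>\<^sub>L 'b::complex_hilbert) \<Rightarrow> ('b \<Rightarrow>\<^sub>L 'a)"
    ("_\<^sup>\<dagger>" [1000] 999)
  where "T\<^sup>\<dagger> = (THE S. \<forall>x y. cinner (blinfun_apply S y) x = cinner y (blinfun_apply T x))"

definition isometry_op :: "('a::complex_hilbert \<Rightarrow>\<^sub>L 'b::complex_hilbert) \<Rightarrow> bool"
  where "isometry_op T \<longleftrightarrow> T \<in> bounded_ops \<and> (\<forall>x. norm (blinfun_apply T x) = norm x)"

definition unitary_op :: "('a::complex_hilbert \<Rightarrow>\<^sub>L 'a) \<Rightarrow> bool"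
  where "unitary_op U \<longleftrightarrow>
    U \<in> bounded_ops \<and> U\<^sup>\<dagger> o\<^sub>L U = id_blinfun \<and> U o\<^sub>L U\<^sup>\<dagger> = id_blinfun"

definition pow_op :: "('a::complex_hilbert \<Rightarrow>\<^sub>L 'a) \<Rightarrow> nat \<Rightarrow> ('a \<Rightarrow>\<^sub>L 'a)"
  where "pow_op T n = ((\<lambda>S. T o\<^sub>L S) ^^ n) id_blinfun"

text \<open>Integer powers of a unitary operator, whose inverse is its adjoint.\<close>

definition powi_op :: "('a::complex_hilbert \<Rightarrow>\<^sub>L 'a) \<Rightarrow> int \<Rightarrow> ('a \<Rightarrow>\<^sub>L 'a)"
  where "powi_op U k = (if k \<ge> 0 then pow_op U (nat k) else pow_op (U\<^sup>\<dagger>) (nat (- k)))"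

text \<open>
  Unital C*-algebras of operators: norm-closed *-subalgebras of the bounded operators
  containing the identity operator of the space.
\<close>

definition unital_cstar_algebra :: "('a::complex_hilbert \<Rightarrow>\<^sub>L 'a) set \<Rightarrow> bool"
  where "unital_cstar_algebra \<AA> \<longleftrightarrow>
    \<AA> \<subseteq> bounded_ops \<and>
    id_blinfun \<in> \<AA> \<and>
    (\<forall>A\<in>\<AA>. \<forall>B\<in>\<AA>. A + B \<in> \<AA>) \<and>
    (\<forall>c. \<forall>A\<in>\<AA>. scale_op c A \<in> \<AA>) \<and>
    (\<forall>A\<in>\<AA>. \<forall>B\<in>\<AA>. A o\<^sub>L B \<in> \<AA>) \<and>
    (\<forall>A\<in>\<AA>. A\<^sup>\<dagger> \<in> \<AA>) \<and>
    closed \<AA>"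

text \<open>
  The triple of the unitary \<open>V_hat\<close>, its underlying Hilbert space (the type \<open>'b\<close>) and the
  embedding \<open>Z\<close> is a minimal unitary dilation of \<open>V\<close>.
\<close>

definition minimal_unitary_dilation ::
  "('a::complex_hilbert \<Rightarrow>\<^sub>L 'a) \<Rightarrow> ('b::complex_hilbert \<Rightarrow>\<^sub>L 'b) \<Rightarrow> ('a \<Rightarrow>\<^sub>L 'b) \<Rightarrow> bool"
  where "minimal_unitary_dilation V V_hat Z \<longleftrightarrow>
    isometry_op Z \<and>
    unitary_op V_hat \<and>
    (\<forall>n. pow_op V_hat n o\<^sub>L Z = Z o\<^sub>L pow_op V n) \<and>
    closure (complex_vector.span (\<Union>k. range (blinfun_apply (powi_op V_hat k o\<^sub>L Z)))) = UNIV"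

end

theory Submission imports Defs begin

text \<open>
  Write \<open>U\<close> for the unitary \<open>V_hat\<close>. An algebra with the required properties has to contain all
  operators \<open>U\<^sup>\<dagger>\<^sup>n Z A Z\<^sup>\<dagger> U\<^sup>n\<close> with \<open>A \<in> \<AA>\<close> and \<open>n \<ge> 0\<close>, and the only real question is why
  compressing products of these by \<open>Z\<close> leads back into \<open>\<AA>\<close>. From \<open>U Z = Z V\<close> one gets that
  \<open>Z\<^sup>\<dagger> U\<^sup>d Z\<close> is \<open>V\<^sup>d\<close> for \<open>d \<ge> 0\<close> and a power of \<open>V\<^sup>\<dagger>\<close> for \<open>d < 0\<close>, so the compression of a
  product with exponents \<open>n\<^sub>1, \<dots>, n\<^sub>r\<close> is a word in \<open>V\<close>, \<open>V\<^sup>\<dagger>\<close> and elements of \<open>\<AA>\<close> that describes a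
  path of heights \<open>0, n\<^sub>1, \<dots>, n\<^sub>r, 0\<close> (\<open>V\<close> and \<open>V\<^sup>\<dagger>\<close> being the unit steps). The path never goes
  below \<open>0\<close>, so each excursion is enclosed by a pair \<open>V\<^sup>\<dagger> \<dots> V\<close>, and it collapses into \<open>\<AA>\<close>
  from the inside out because \<open>V\<^sup>\<dagger> \<AA> V \<subseteq> \<AA>\<close>.

  The proof replaces the induction on words, and the norm closure of their span, by invariant
  subspaces. Let \<open>height_ops \<AA> V n\<close> be the set of all \<open>T\<close> for which every descent
  \<open>V\<^sup>\<dagger> A\<^sub>1 \<dots> V\<^sup>\<dagger> A\<^sub>n T\<close> ends in \<open>\<AA>\<close>. These are closed left \<open>\<AA>\<close>-modules, level \<open>0\<close> is \<open>\<AA>\<close>, and \<open>V\<close>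
  and \<open>V\<^sup>\<dagger>\<close> move up and down one level. Let \<open>M\<^sub>k\<close> be the closed subspace of all \<open>Y\<close> such that
  \<open>Z\<^sup>\<dagger> U\<^sup>j U\<^sup>\<dagger>\<^sup>k Y\<close> has height \<open>j\<close> for every \<open>j\<close>. The required algebra is the set of all bounded
  \<open>X\<close> such that \<open>X\<close> and \<open>X\<^sup>\<dagger>\<close> map every \<open>M\<^sub>k\<close> into itself: for any closed subspaces this is a
  unital C*-algebra (\<open>stabilizer_unital_cstar_algebra\<close>). It contains \<open>Z \<AA> Z\<^sup>\<dagger>\<close> since \<open>Z\<^sup>\<dagger>\<close> maps \<open>M\<^sub>k\<close>
  to height \<open>k\<close> and \<open>Z\<close> maps height \<open>k\<close> back into \<open>M\<^sub>k\<close> (\<open>embedded_alg_in_stabilizer\<close>); it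
  compresses into \<open>\<AA>\<close> since \<open>Z \<in> M\<^sub>0\<close> and \<open>Z\<^sup>\<dagger> M\<^sub>0 \<subseteq> \<AA>\<close> (\<open>stabilizer_compression\<close>); and it is
  invariant under \<open>X \<mapsto> U\<^sup>\<dagger> X U\<close> since \<open>U\<close> shifts \<open>M\<^sub>k\<close> to \<open>M\<^sub>k\<^sub>+\<^sub>1\<close>
  (\<open>stabilizer_conjugation\<close>). The two identities of the theorem follow from \<open>U Z = Z V\<close> and
  \<open>Z\<^sup>\<dagger> Z = 1\<close>.

  The calculus of adjoints that this needs rests on the Riesz representation theorem, proved
  below by minimising a quadratic functional.
\<close>

section \<open>Inner product identities\<close>

lemma cinner_add_left: "cinner (x + y) z = cinner x z + cinner y z"
proof -
  have "cinner (x + y) z = cnj (cinner z x + cinner z y)"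
    by (metis cinner_commute cinner_add_right)
  then show ?thesis
    by (metis cinner_commute complex_cnj_add)
qed

lemma cinner_scaleC_left: "cinner (c *\<^sub>C x) y = cnj c * cinner x y"
  by (metis cinner_commute cinner_scaleC_right complex_cnj_mult)

lemma cinner_scaleR_right: "cinner x (r *\<^sub>R y) = complex_of_real r * cinner x y"
  by (metis cinner_scaleC_right scaleC_of_real)

lemma cinner_diff_right: "cinner x (y - z) = cinner x y - cinner x z"
  by (metis add_diff_cancel_right' cinner_add_right diff_add_cancel)

lemma cinner_diff_left: "cinner (x - y) z = cinner x z - cinner y z"
  by (metis add_diff_cancel_right' cinner_add_left diff_add_cancel)

lemma norm_add_square: "(norm (x + y))\<^sup>2 = (norm x)\<^sup>2 + 2 * Re (cinner x y) + (norm y)\<^sup>2"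
  for x y :: "'a::complex_hilbert"
proof -
  have "complex_of_real ((norm (x + y))\<^sup>2)
      = complex_of_real ((norm x)\<^sup>2) + (cinner x y + cnj (cinner x y)) + complex_of_real ((norm y)\<^sup>2)"
    unfolding cinner_self[symmetric] cinner_add_left cinner_add_right
    by (simp add: cinner_commute[of y x])
  then have "Re (complex_of_real ((norm (x + y))\<^sup>2))
      = Re (complex_of_real ((norm x)\<^sup>2) + (cinner x y + cnj (cinner x y)) + complex_of_real ((norm y)\<^sup>2))"
    by (rule arg_cong)
  then show ?thesis by simp
qed

lemma Re_cinner_scaleR_right: "Re (cinner x (r *\<^sub>R y)) = r * Re (cinner x y)"
  by (simp add: cinner_scaleR_right)

lemma parallelogram:
  "(norm (x + y))\<^sup>2 + (norm (x - y))\<^sup>2 = 2 * (norm x)\<^sup>2 + 2 * (norm y)\<^sup>2"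
  for x y :: "'a::complex_hilbert"
proof -
  have "(norm (x - y))\<^sup>2 = (norm x)\<^sup>2 - 2 * Re (cinner x y) + (norm y)\<^sup>2"
    using norm_add_square[of x "- 1 *\<^sub>R y"] unfolding Re_cinner_scaleR_right by simp
  then show ?thesis by (simp add: norm_add_square)
qed

lemma Cauchy_Schwarz: "cmod (cinner x y) \<le> norm x * norm y"
  for x y :: "'a::complex_hilbert"
proof -
  \<comment> \<open>Polarisation turns the triangle inequality of the norm into a bound on real parts.\<close>
  have re: "Re (cinner x z) \<le> norm x * norm z" for z
  proof -
    have "(norm (x + z))\<^sup>2 \<le> (norm x + norm z)\<^sup>2"
      by (intro power_mono norm_triangle_ineq) simp
    then show ?thesis by (simp add: norm_add_square power2_sum)
  qed
  show ?thesis
  proof (cases "cinner x y = 0")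
    case False
    \<comment> \<open>A phase rotates the inner product onto the positive real axis.\<close>
    define u where "u = cnj (sgn (cinner x y))"
    have "cmod u = 1" using False by (simp add: u_def norm_sgn)
    have "cinner x (u *\<^sub>C y) = cmod (cinner x y)"
      by (simp add: cinner_scaleC_right u_def sgn_eq complex_norm_square[symmetric] mult.commute
          power2_eq_square False divide_simps)
    then show ?thesis using re[of "u *\<^sub>C y"] \<open>cmod u = 1\<close> by (simp add: norm_scaleC)
  qed simp
qed

lemma cinner_ext:
  assumes "\<And>x. cinner y x = cinner z x"
  shows "y = z"
proof -
  have "cinner (y - z) (y - z) = 0" by (simp add: cinner_diff_left assms)
  then show ?thesis by (simp add: cinner_self)
qed

text \<open>
  A complex-linear functional is determined by its real part, because its imaginary part at \<open>x\<close>
  is minus its real part at \<open>\<i> *\<^sub>C x\<close>.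
\<close>

lemma Re_cinner_ext_complex:
  assumes "\<And>x. Re (cinner z x) = Re (f x)" and "\<And>c x. f (c *\<^sub>C x) = c * f x"
  shows "cinner z x = f x"
  using assms(1)[of x] assms(1)[of "\<i> *\<^sub>C x"]
  by (simp add: complex_eq_iff assms(2) cinner_scaleC_right)

section \<open>Riesz representation\<close>

lemma linear_term_eq_0:
  fixes a b :: real
  assumes "\<And>t. 0 \<le> t * a + t\<^sup>2 * b" and "0 \<le> b"
  shows "a = 0"
proof -
  \<comment> \<open>The vertex of the parabola is at \<open>- a / (2 * b)\<close>; a slightly different denominator also
    covers \<open>b = 0\<close> and still gives a negative value unless \<open>a = 0\<close>.\<close>
  have "0 \<le> (- a / (b + 1)) * a + (- a / (b + 1))\<^sup>2 * b" by (rule assms(1))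
  also have "\<dots> = - (a\<^sup>2 / (b + 1)\<^sup>2)"
    using assms(2) by (simp add: divide_simps power2_eq_square) (simp add: algebra_simps)
  finally have "a\<^sup>2 / (b + 1)\<^sup>2 \<le> 0" by simp
  then show ?thesis using assms(2) by (simp add: divide_le_0_iff)
qed

text \<open>
  The representing vector is the minimiser of the energy \<open>\<lambda>x. (norm x)\<^sup>2 / 2 - Re (f x)\<close>. By the
  parallelogram law the squared distance of two points is controlled by the excess of
  their energies over the infimum, so a minimising sequence is Cauchy and completeness provides
  the minimiser; the first-order condition there is the claim for real parts, which suffice.
\<close>

lemma riesz_representation:
  fixes f :: "'a::complex_hilbert \<Rightarrow> complex"
  assumes "bounded_linear f" and homog: "\<And>c x. f (c *\<^sub>C x) = c * f x"
  shows "\<exists>z. \<forall>x. cinner z x = f x"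
proof -
  interpret f: bounded_linear f by fact
  define J where "J x = (norm x)\<^sup>2 / 2 - Re (f x)" for x
  obtain K where K: "\<And>x. cmod (f x) \<le> norm x * K" using f.bounded by blast
  have lower: "J x \<ge> - (K\<^sup>2 / 2)" for x
  proof -
    have "Re (f x) \<le> norm x * K" using K[of x] complex_Re_le_cmod[of "f x"] by linarith
    moreover have "0 \<le> (norm x - K)\<^sup>2" by simp
    ultimately show ?thesis by (simp add: J_def power2_diff field_simps)
  qed
  define m where "m = Inf (range J)"
  have bdd: "bdd_below (range J)" using lower by (auto intro!: bdd_belowI)
  have m_le: "m \<le> J x" for x unfolding m_def by (rule cInf_lower[OF _ bdd]) simp
  have "\<exists>x. J x < m + 1 / real (Suc n)" for n
    using cInf_lessD[of "range J" "m + 1 / real (Suc n)"] by (auto simp: m_def)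
  then obtain X where X: "\<And>n. J (X n) < m + 1 / real (Suc n)" by metis
  have gap: "(norm (x - y))\<^sup>2 \<le> 4 * ((J x - m) + (J y - m))" for x y
  proof -
    have "(norm ((1/2) *\<^sub>R (x + y)))\<^sup>2 = (norm (x + y))\<^sup>2 / 4"
      by (simp add: power_divide)
    then have "J ((1/2) *\<^sub>R (x + y)) = (norm (x + y))\<^sup>2 / 8 - (Re (f x) + Re (f y)) / 2"
      by (simp add: J_def f.scaleR f.add)
    then show ?thesis
      using m_le[of "(1/2) *\<^sub>R (x + y)"] parallelogram[of x y] by (simp add: J_def field_simps)
  qed
  have "Cauchy X"
  proof (rule metric_CauchyI)
    fix e :: real assume "0 < e"
    then obtain N where N: "1 / real (Suc N) < e\<^sup>2 / 8"
      by (metis nat_approx_posE zero_less_divide_iff zero_less_numeral zero_less_power)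
    have "dist (X i) (X j) < e" if "i \<ge> N" "j \<ge> N" for i j
    proof -
      have "1 / real (Suc i) \<le> 1 / real (Suc N)" "1 / real (Suc j) \<le> 1 / real (Suc N)"
        using that by (simp_all add: frac_le)
      then have "(norm (X i - X j))\<^sup>2 < e\<^sup>2"
        using gap[of "X i" "X j"] X[of i] X[of j] N by argo
      then show ?thesis using \<open>0 < e\<close> by (simp add: dist_norm power_less_imp_less_base)
    qed
    then show "\<exists>M. \<forall>i\<ge>M. \<forall>j\<ge>M. dist (X i) (X j) < e" by blast
  qed
  then obtain w where w: "X \<longlonglongrightarrow> w" using Cauchy_convergent convergent_def by blast
  have "(\<lambda>n. J (X n)) \<longlonglongrightarrow> J w"
    unfolding J_def by (intro tendsto_intros f.tendsto w) simp
  moreover have "(\<lambda>n. m + 1 / real (Suc n)) \<longlonglongrightarrow> m"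
    using tendsto_add[OF tendsto_const[of m] LIMSEQ_inverse_real_of_nat]
    by (simp add: inverse_eq_divide)
  ultimately have Jw: "J w \<le> m"
    by (rule LIMSEQ_le) (use X less_imp_le in blast)
  have "Re (cinner w x) = Re (f x)" for x
  proof -
    have "0 \<le> t * (Re (cinner w x) - Re (f x)) + t\<^sup>2 * ((norm x)\<^sup>2 / 2)" for t
    proof -
      have "J (w + t *\<^sub>R x)
          = J w + t * (Re (cinner w x) - Re (f x)) + t\<^sup>2 * ((norm x)\<^sup>2 / 2)"
        by (simp add: J_def norm_add_square Re_cinner_scaleR_right f.add f.scaleR
            power_mult_distrib field_simps)
      then show ?thesis using m_le[of "w + t *\<^sub>R x"] Jw by linarith
    qed
    from linear_term_eq_0[OF this] show ?thesis by simp
  qed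
  then have "cinner w x = f x" for x using homog by (rule Re_cinner_ext_complex)
  then show ?thesis by blast
qed

section \<open>Adjoint calculus\<close>

lemma adj_op_eqI:
  assumes "\<And>x y. cinner (blinfun_apply S y) x = cinner y (blinfun_apply T x)"
  shows "T\<^sup>\<dagger> = S"
  unfolding adj_op_def
proof (rule the_equality)
  show "S' = S" if "\<forall>x y. cinner (blinfun_apply S' y) x = cinner y (blinfun_apply T x)" for S'
  proof (intro blinfun_eqI cinner_ext)
    show "cinner (S' y) x = cinner (S y) x" for x y
      by (rule trans[OF that[rule_format] assms[symmetric]])
  qed
  show "\<forall>x y. cinner (S y) x = cinner y (T x)"
    by (intro allI assms)
qed

text \<open>
  Pairing \<open>s\<close> with itself gives the operator norm bound that makes the adjoint bounded, and
  then, for an existing adjoint, its norm estimate.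
\<close>

lemma norm_representing_vector_le:
  assumes "\<And>x. cinner s x = cinner y (blinfun_apply T x)"
  shows "norm s \<le> norm T * norm y"
proof (cases "s = 0")
  case False
  have "(norm s)\<^sup>2 = cmod (cinner y (T s))"
    unfolding assms[symmetric] by (simp add: cinner_self norm_power)
  also have "\<dots> \<le> norm y * norm (T s)" by (rule Cauchy_Schwarz)
  also have "\<dots> \<le> norm y * (norm T * norm s)"
    by (intro mult_left_mono norm_blinfun) simp
  finally have "norm s * norm s \<le> (norm T * norm y) * norm s"
    by (simp add: power2_eq_square mult_ac)
  then show ?thesis by (rule mult_right_le_imp_le) (simp add: False)
qed simp

lemma adjoint_exists:
  fixes T :: "'a::complex_hilbert \<Rightarrow>\<^sub>L 'b::complex_hilbert"
  assumes "T \<in> bounded_ops"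
  shows "\<exists>S. \<forall>x y. cinner (blinfun_apply S y) x = cinner y (blinfun_apply T x)"
proof -
  have homog: "T (c *\<^sub>C x) = c *\<^sub>C T x" for c x
    using assms by (simp add: bounded_ops_def)
  have "\<exists>z. \<forall>x. cinner z x = cinner y (T x)" for y
  proof (rule riesz_representation)
    show "bounded_linear (\<lambda>x. cinner y (T x))"
    proof (rule bounded_linear_intro)
      show "norm (cinner y (T x)) \<le> norm x * (norm y * norm T)" for x
      proof -
        have "norm (cinner y (T x)) \<le> norm y * norm (T x)" by (rule Cauchy_Schwarz)
        also have "\<dots> \<le> norm y * (norm T * norm x)"
          by (intro mult_left_mono norm_blinfun) simp
        finally show ?thesis by (simp add: mult_ac)
      qed
    qed (simp_all add: blinfun.bilinear_simps cinner_add_right cinner_scaleR_right scaleR_conv_of_real)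
  qed (simp add: homog cinner_scaleC_right)
  then obtain S where S: "\<And>x y. cinner (S y) x = cinner y (T x)" by metis
  have "bounded_linear S"
  proof (rule bounded_linear_intro)
    show "S (x + y) = S x + S y" for x y
      by (rule cinner_ext) (simp add: S cinner_add_left)
    show "S (r *\<^sub>R x) = r *\<^sub>R S x" for r x
      by (rule cinner_ext) (simp add: S cinner_scaleC_left flip: scaleC_of_real)
    show "norm (S y) \<le> norm y * norm T" for y
      using norm_representing_vector_le[of "S y" y T] S by (simp add: mult.commute)
  qed
  then show ?thesis using S by (intro exI[of _ "Blinfun S"]) (simp add: bounded_linear_Blinfun_apply)
qed

lemma cinner_adj_left:
  assumes "T \<in> bounded_ops"
  shows "cinner (blinfun_apply (T\<^sup>\<dagger>) y) x = cinner y (blinfun_apply T x)"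
proof -
  obtain S where S: "\<And>x y. cinner (blinfun_apply S y) x = cinner y (blinfun_apply T x)"
    using adjoint_exists[OF assms] by blast
  then have "T\<^sup>\<dagger> = S" by (rule adj_op_eqI)
  then show ?thesis by (simp add: S)
qed

lemma cinner_adj_right:
  assumes "T \<in> bounded_ops"
  shows "cinner x (blinfun_apply (T\<^sup>\<dagger>) y) = cinner (blinfun_apply T x) y"
proof -
  have "cinner x (blinfun_apply (T\<^sup>\<dagger>) y) = cnj (cinner (blinfun_apply (T\<^sup>\<dagger>) y) x)" by (rule cinner_commute)
  also have "\<dots> = cnj (cinner y (T x))" by (simp only: cinner_adj_left[OF assms])
  also have "\<dots> = cinner (T x) y" by (rule cinner_commute[symmetric])
  finally show ?thesis .
qed

lemma adj_op_bounded_ops: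
  assumes "T \<in> bounded_ops"
  shows "T\<^sup>\<dagger> \<in> bounded_ops"
  unfolding bounded_ops_def
proof (intro CollectI allI cinner_ext)
  show "cinner (blinfun_apply (T\<^sup>\<dagger>) (c *\<^sub>C x)) y = cinner (c *\<^sub>C blinfun_apply (T\<^sup>\<dagger>) x) y" for c x y
    by (simp add: cinner_adj_left[OF assms] cinner_scaleC_left)
qed

lemma adj_op_adj_op: "T \<in> bounded_ops \<Longrightarrow> (T\<^sup>\<dagger>)\<^sup>\<dagger> = T"
  by (rule adj_op_eqI) (simp add: cinner_adj_right)

lemma id_bounded_ops: "id_blinfun \<in> bounded_ops"
  by (simp add: bounded_ops_def)

lemma adj_op_id: "id_blinfun\<^sup>\<dagger> = id_blinfun"
  by (rule adj_op_eqI) simp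

lemma compose_bounded_ops: "S \<in> bounded_ops \<Longrightarrow> T \<in> bounded_ops \<Longrightarrow> S o\<^sub>L T \<in> bounded_ops"
  by (simp add: bounded_ops_def)

lemma adj_op_compose:
  "S \<in> bounded_ops \<Longrightarrow> T \<in> bounded_ops \<Longrightarrow> (S o\<^sub>L T)\<^sup>\<dagger> = T\<^sup>\<dagger> o\<^sub>L S\<^sup>\<dagger>"
  by (rule adj_op_eqI) (simp add: cinner_adj_left)

lemma add_bounded_ops: "S \<in> bounded_ops \<Longrightarrow> T \<in> bounded_ops \<Longrightarrow> S + T \<in> bounded_ops"
  by (simp add: bounded_ops_def blinfun.bilinear_simps scaleC_add_right)

lemma diff_bounded_ops: "S \<in> bounded_ops \<Longrightarrow> T \<in> bounded_ops \<Longrightarrow> S - T \<in> bounded_ops"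
  by (simp add: bounded_ops_def blinfun.bilinear_simps complex_vector.scale_right_diff_distrib)

lemma adj_op_add:
  "S \<in> bounded_ops \<Longrightarrow> T \<in> bounded_ops \<Longrightarrow> (S + T)\<^sup>\<dagger> = S\<^sup>\<dagger> + T\<^sup>\<dagger>"
  by (rule adj_op_eqI)
    (simp add: blinfun.bilinear_simps cinner_add_left cinner_add_right cinner_adj_left)

lemma adj_op_diff:
  "S \<in> bounded_ops \<Longrightarrow> T \<in> bounded_ops \<Longrightarrow> (S - T)\<^sup>\<dagger> = S\<^sup>\<dagger> - T\<^sup>\<dagger>"
  by (rule adj_op_eqI)
    (simp add: blinfun.bilinear_simps cinner_diff_left cinner_diff_right cinner_adj_left)

lemma scale_bounded_ops: "T \<in> bounded_ops \<Longrightarrow> scale_op c T \<in> bounded_ops"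
  by (simp add: bounded_ops_def scale_op.rep_eq scaleC_scaleC mult.commute)

lemma adj_op_scale: "T \<in> bounded_ops \<Longrightarrow> (scale_op c T)\<^sup>\<dagger> = scale_op (cnj c) (T\<^sup>\<dagger>)"
  by (rule adj_op_eqI)
    (simp add: scale_op.rep_eq cinner_scaleC_left cinner_scaleC_right cinner_adj_left)

lemma compose_assoc: "(A o\<^sub>L B) o\<^sub>L C = A o\<^sub>L (B o\<^sub>L C)"
  by (rule blinfun_eqI) simp

lemma compose_eq_assoc: "A o\<^sub>L B = C \<Longrightarrow> A o\<^sub>L (B o\<^sub>L T) = C o\<^sub>L T"
  by (simp flip: compose_assoc)

lemma compose_id [simp]: "A o\<^sub>L id_blinfun = A" "id_blinfun o\<^sub>L A = A"
  by (auto intro: blinfun_eqI)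

lemma compose_scale: "A \<in> bounded_ops \<Longrightarrow> A o\<^sub>L scale_op c T = scale_op c (A o\<^sub>L T)"
  by (rule blinfun_eqI) (simp add: scale_op.rep_eq bounded_ops_def)

lemma scale_compose: "scale_op c A o\<^sub>L T = scale_op c (A o\<^sub>L T)"
  by (rule blinfun_eqI) (simp add: scale_op.rep_eq)

lemma norm_adj_op_le:
  assumes "T \<in> bounded_ops"
  shows "norm (T\<^sup>\<dagger>) \<le> norm T"
  by (rule norm_blinfun_bound)
    (simp_all add: norm_representing_vector_le cinner_adj_left[OF assms])

lemma closed_bounded_ops: "closed (bounded_ops :: ('a::complex_hilbert \<Rightarrow>\<^sub>L 'b::complex_hilbert) set)"
proof -
  have "closed {T :: 'a \<Rightarrow>\<^sub>L 'b. T (c *\<^sub>C x) = c *\<^sub>C T x}" for c x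
    by (intro closed_Collect_eq continuous_intros
        bounded_linear.continuous_on[OF bounded_linear_scaleC])
  moreover have "bounded_ops = (\<Inter>c x. {T :: 'a \<Rightarrow>\<^sub>L 'b. T (c *\<^sub>C x) = c *\<^sub>C T x})"
    by (auto simp: bounded_ops_def)
  ultimately show ?thesis by (metis (no_types, lifting) closed_INT)
qed

text \<open>
  Taking adjoints is additive and does not increase the norm, hence it is continuous; this makes
  conditions on \<open>X\<^sup>\<dagger>\<close> closed conditions on \<open>X\<close>.
\<close>

lemma tendsto_adj_op:
  assumes "\<And>n. X n \<in> bounded_ops" and "T \<in> bounded_ops" and "X \<longlonglongrightarrow> T"
  shows "(\<lambda>n. (X n)\<^sup>\<dagger>) \<longlonglongrightarrow> T\<^sup>\<dagger>"
proof (rule Lim_transform_bound[where g = "\<lambda>n. norm (X n - T)", THEN LIM_zero_cancel])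
  show "eventually (\<lambda>n. norm ((X n)\<^sup>\<dagger> - T\<^sup>\<dagger>) \<le> norm (norm (X n - T))) sequentially"
    using assms(1,2) by (simp add: adj_op_diff[symmetric] norm_adj_op_le diff_bounded_ops)
  show "(\<lambda>n. norm (X n - T)) \<longlonglongrightarrow> 0"
    using assms(3) by (simp add: LIM_zero tendsto_norm_zero)
qed

lemma pow_op_0 [simp]: "pow_op T 0 = id_blinfun"
  by (simp add: pow_op_def)

lemma pow_op_Suc: "pow_op T (Suc n) = T o\<^sub>L pow_op T n"
  by (simp add: pow_op_def)

lemma pow_op_Suc_right: "pow_op T (Suc n) = pow_op T n o\<^sub>L T"
  by (induction n) (simp_all add: pow_op_Suc compose_assoc[symmetric])

lemma pow_bounded_ops: "T \<in> bounded_ops \<Longrightarrow> pow_op T n \<in> bounded_ops"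
  by (induction n) (simp_all add: pow_op_Suc id_bounded_ops compose_bounded_ops)

lemma isometry_adj_compose:
  assumes "isometry_op Z"
  shows "Z\<^sup>\<dagger> o\<^sub>L Z = id_blinfun"
proof -
  have bdd: "Z \<in> bounded_ops" and iso: "\<And>x. norm (Z x) = norm x"
    using assms by (auto simp: isometry_op_def)
  \<comment> \<open>Polarisation: the norm determines the real part of the inner product.\<close>
  have re: "Re (cinner (Z y) (Z x)) = Re (cinner y x)" for x y
    using norm_add_square[of "Z y" "Z x"] norm_add_square[of y x]
    by (simp add: iso flip: blinfun.add_right)
  have "cinner ((Z\<^sup>\<dagger> o\<^sub>L Z) y) x = cinner y x" for x y
    by (rule Re_cinner_ext_complex)
      (simp_all add: cinner_adj_left[OF bdd] re cinner_scaleC_right)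
  then show ?thesis by (intro blinfun_eqI cinner_ext) simp
qed

section \<open>Stabiliser algebras\<close>

definition closed_op_subspace :: "('a::complex_hilbert \<Rightarrow>\<^sub>L 'b::complex_hilbert) set \<Rightarrow> bool"
  where "closed_op_subspace S \<longleftrightarrow>
    (\<forall>A\<in>S. \<forall>B\<in>S. A + B \<in> S) \<and> (\<forall>c. \<forall>A\<in>S. scale_op c A \<in> S) \<and> closed S"

lemma closed_op_subspace_compose_vimage:
  assumes "closed_op_subspace S" and "C \<in> bounded_ops"
  shows "closed_op_subspace {T. C o\<^sub>L T \<in> S}"
proof -
  have "closed S" using assms(1) by (simp add: closed_op_subspace_def)
  moreover have "continuous_on UNIV (\<lambda>T. C o\<^sub>L T)" by (intro continuous_intros)
  ultimately have "closed ((\<lambda>T. C o\<^sub>L T) -` S)" by (rule closed_vimage)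
  then show ?thesis
    using assms
    by (simp add: closed_op_subspace_def vimage_def compose_scale
        bounded_bilinear.add_right[OF bounded_bilinear_blinfun_compose])
qed

lemma closed_op_subspace_Inter:
  "(\<And>i. i \<in> I \<Longrightarrow> closed_op_subspace (S i)) \<Longrightarrow> closed_op_subspace (\<Inter>i\<in>I. S i)"
  by (simp add: closed_op_subspace_def closed_INT)

text \<open>
  The condition on \<open>X\<^sup>\<dagger>\<close> makes the set self-adjoint; the stabiliser of a subspace alone need not
  be.
\<close>

definition stabilizer :: "(nat \<Rightarrow> ('a::complex_hilbert \<Rightarrow>\<^sub>L 'b::complex_hilbert) set) \<Rightarrow> ('b \<Rightarrow>\<^sub>L 'b) set"
  where "stabilizer M =
    {X \<in> bounded_ops. \<forall>k. \<forall>Y\<in>M k. X o\<^sub>L Y \<in> M k \<and> X\<^sup>\<dagger> o\<^sub>L Y \<in> M k}"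

lemma stabilizer_unital_cstar_algebra:
  assumes "\<And>k. closed_op_subspace (M k)"
  shows "unital_cstar_algebra (stabilizer M)"
proof -
  have add: "A + B \<in> M k" if "A \<in> M k" "B \<in> M k" for A B k
    using assms[of k] that by (simp add: closed_op_subspace_def)
  have scale: "scale_op c A \<in> M k" if "A \<in> M k" for A c k
    using assms[of k] that by (simp add: closed_op_subspace_def)
  have cl: "closed (M k)" for k
    using assms[of k] by (simp add: closed_op_subspace_def)
  have "closed (stabilizer M)"
    unfolding closed_sequential_limits
  proof (intro allI impI, elim conjE)
    fix X T assume X: "\<forall>n. X n \<in> stabilizer M" and lim: "X \<longlonglongrightarrow> T"
    have Xb: "X n \<in> bounded_ops" for n using X by (simp add: stabilizer_def)
    have Tb: "T \<in> bounded_ops"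
      using closed_bounded_ops Xb lim by (rule closed_sequentially)
    have "T o\<^sub>L Y \<in> M k \<and> T\<^sup>\<dagger> o\<^sub>L Y \<in> M k" if "Y \<in> M k" for k Y
    proof
      have XY: "X n o\<^sub>L Y \<in> M k" "(X n)\<^sup>\<dagger> o\<^sub>L Y \<in> M k" for n
        using X that by (simp_all add: stabilizer_def)
      have "(\<lambda>n. X n o\<^sub>L Y) \<longlonglongrightarrow> (T o\<^sub>L Y)"
        by (intro bounded_bilinear.tendsto[OF bounded_bilinear_blinfun_compose] lim tendsto_const)
      then show "T o\<^sub>L Y \<in> M k" by (rule closed_sequentially[OF cl XY(1)])
      have "(\<lambda>n. (X n)\<^sup>\<dagger>) \<longlonglongrightarrow> T\<^sup>\<dagger>" using Xb Tb lim by (rule tendsto_adj_op)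
      then have "(\<lambda>n. (X n)\<^sup>\<dagger> o\<^sub>L Y) \<longlonglongrightarrow> (T\<^sup>\<dagger> o\<^sub>L Y)"
        by (intro bounded_bilinear.tendsto[OF bounded_bilinear_blinfun_compose] tendsto_const)
      then show "T\<^sup>\<dagger> o\<^sub>L Y \<in> M k" by (rule closed_sequentially[OF cl XY(2)])
    qed
    then show "T \<in> stabilizer M" using Tb by (simp add: stabilizer_def)
  qed
  moreover have "A + B \<in> stabilizer M" if "A \<in> stabilizer M" "B \<in> stabilizer M" for A B
    using that
    by (simp add: stabilizer_def add_bounded_ops adj_op_add add
        bounded_bilinear.add_left[OF bounded_bilinear_blinfun_compose])
  moreover have "A o\<^sub>L B \<in> stabilizer M" if "A \<in> stabilizer M" "B \<in> stabilizer M" for A B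
    using that by (simp add: stabilizer_def compose_bounded_ops adj_op_compose compose_assoc)
  moreover have "scale_op c A \<in> stabilizer M" if "A \<in> stabilizer M" for c A
    using that by (simp add: stabilizer_def scale_bounded_ops adj_op_scale scale_compose scale)
  moreover have "A\<^sup>\<dagger> \<in> stabilizer M" if "A \<in> stabilizer M" for A
    using that by (simp add: stabilizer_def adj_op_bounded_ops adj_op_adj_op)
  moreover have "id_blinfun \<in> stabilizer M"
    by (simp add: stabilizer_def id_bounded_ops adj_op_id)
  moreover have "stabilizer M \<subseteq> bounded_ops" by (auto simp: stabilizer_def)
  ultimately show ?thesis
    by (simp add: unital_cstar_algebra_def)
qed

section \<open>The height filtration and the dilated algebra\<close>

text \<open>
  \<open>T\<close> has height \<open>n\<close> if \<open>V\<^sup>\<dagger> A\<^sub>1 \<dots> V\<^sup>\<dagger> A\<^sub>n T \<in> \<AA>\<close> for all choices of \<open>A\<^sub>1, \<dots>, A\<^sub>n \<in> \<AA>\<close>; the power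
  \<open>V\<^sup>n\<close> is the typical example. Allowing an element of \<open>\<AA>\<close> before each step down is what makes
  every level a left \<open>\<AA>\<close>-module, and asking for all descents, instead of generating from
  \<open>V\<^sup>n\<close>, makes it closed.
\<close>

primrec height_ops :: "('a::complex_hilbert \<Rightarrow>\<^sub>L 'a) set \<Rightarrow> ('a \<Rightarrow>\<^sub>L 'a) \<Rightarrow> nat \<Rightarrow> ('a \<Rightarrow>\<^sub>L 'a) set"
  where
    "height_ops \<AA> V 0 = \<AA>"
  | "height_ops \<AA> V (Suc n) = {T. \<forall>A\<in>\<AA>. V\<^sup>\<dagger> o\<^sub>L A o\<^sub>L T \<in> height_ops \<AA> V n}"

text \<open>
  Since \<open>U\<close> is unitary, \<open>U\<^sup>j U\<^sup>\<dagger>\<^sup>k\<close> is the integer power \<open>U\<^sup>j\<^sup>-\<^sup>k\<close>; two natural exponents allow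
  induction on both. So \<open>dilation_module \<AA> V U Z k\<close> is \<open>U\<^sup>k\<close> applied to the module for \<open>k = 0\<close>.
  The intersection over all \<open>j\<close>, not only \<open>j = k\<close>, is what makes \<open>U\<close> shift \<open>k\<close>.
\<close>

definition dilation_module ::
  "('a::complex_hilbert \<Rightarrow>\<^sub>L 'a) set \<Rightarrow> ('a \<Rightarrow>\<^sub>L 'a) \<Rightarrow> ('b::complex_hilbert \<Rightarrow>\<^sub>L 'b) \<Rightarrow> ('a \<Rightarrow>\<^sub>L 'b) \<Rightarrow>
    nat \<Rightarrow> ('a \<Rightarrow>\<^sub>L 'b) set"
  where "dilation_module \<AA> V U Z k =
    (\<Inter>j. {Y. (Z\<^sup>\<dagger> o\<^sub>L pow_op U j o\<^sub>L pow_op (U\<^sup>\<dagger>) k) o\<^sub>L Y \<in> height_ops \<AA> V j})"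

locale compression_invariant =
  fixes \<AA> :: "('a::complex_hilbert \<Rightarrow>\<^sub>L 'a) set" and V :: "'a \<Rightarrow>\<^sub>L 'a"
  assumes cstar: "unital_cstar_algebra \<AA>"
    and V_bounded: "V \<in> bounded_ops"
    and compress: "A \<in> \<AA> \<Longrightarrow> V\<^sup>\<dagger> o\<^sub>L A o\<^sub>L V \<in> \<AA>"
begin

lemma alg_bounded: "A \<in> \<AA> \<Longrightarrow> A \<in> bounded_ops"
  and alg_id: "id_blinfun \<in> \<AA>"
  and alg_compose: "A \<in> \<AA> \<Longrightarrow> B \<in> \<AA> \<Longrightarrow> A o\<^sub>L B \<in> \<AA>"
  and alg_adj: "A \<in> \<AA> \<Longrightarrow> A\<^sup>\<dagger> \<in> \<AA>"
  using cstar by (auto simp: unital_cstar_algebra_def)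

lemma height_ops_closed_op_subspace: "closed_op_subspace (height_ops \<AA> V n)"
proof (induction n)
  case 0
  then show ?case using cstar by (simp add: unital_cstar_algebra_def closed_op_subspace_def)
next
  case (Suc n)
  have "height_ops \<AA> V (Suc n) = (\<Inter>A\<in>\<AA>. {T. (V\<^sup>\<dagger> o\<^sub>L A) o\<^sub>L T \<in> height_ops \<AA> V n})"
    by auto
  moreover have "closed_op_subspace (\<Inter>A\<in>\<AA>. {T. (V\<^sup>\<dagger> o\<^sub>L A) o\<^sub>L T \<in> height_ops \<AA> V n})"
    by (intro closed_op_subspace_Inter closed_op_subspace_compose_vimage Suc
        compose_bounded_ops adj_op_bounded_ops V_bounded alg_bounded)
  ultimately show ?case by (simp only:)
qed

text \<open>
  An additional factor from \<open>\<AA>\<close> is absorbed by the element of \<open>\<AA>\<close> that precedes the first step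
  down.
\<close>

lemma height_ops_alg: "A \<in> \<AA> \<Longrightarrow> T \<in> height_ops \<AA> V n \<Longrightarrow> A o\<^sub>L T \<in> height_ops \<AA> V n"
proof (cases n)
  case (Suc m)
  assume A: "A \<in> \<AA>" and T: "T \<in> height_ops \<AA> V n"
  have "V\<^sup>\<dagger> o\<^sub>L B o\<^sub>L (A o\<^sub>L T) \<in> height_ops \<AA> V m" if "B \<in> \<AA>" for B
  proof -
    have "V\<^sup>\<dagger> o\<^sub>L (B o\<^sub>L A) o\<^sub>L T \<in> height_ops \<AA> V m"
      using T alg_compose[OF that A] by (simp add: Suc)
    then show ?thesis by (simp add: compose_assoc)
  qed
  then show ?thesis by (simp add: Suc)
qed (simp add: alg_compose)

lemma height_ops_lower: "T \<in> height_ops \<AA> V (Suc n) \<Longrightarrow> V\<^sup>\<dagger> o\<^sub>L T \<in> height_ops \<AA> V n"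
  using alg_id by auto

text \<open>
  One step up followed by one step down multiplies by some \<open>V\<^sup>\<dagger> A V\<close>. This is the only place where
  the invariance \<open>V\<^sup>\<dagger> \<AA> V \<subseteq> \<AA>\<close> enters.
\<close>

lemma height_ops_raise: "T \<in> height_ops \<AA> V n \<Longrightarrow> V o\<^sub>L T \<in> height_ops \<AA> V (Suc n)"
  using height_ops_alg[OF compress] by (simp add: compose_assoc)

lemma height_ops_raise_pow:
  "T \<in> height_ops \<AA> V n \<Longrightarrow> pow_op V j o\<^sub>L T \<in> height_ops \<AA> V (n + j)"
  by (induction j) (simp_all add: pow_op_Suc compose_assoc height_ops_raise del: height_ops.simps)

lemma height_ops_lower_pow:
  "T \<in> height_ops \<AA> V (n + k) \<Longrightarrow> pow_op (V\<^sup>\<dagger>) k o\<^sub>L T \<in> height_ops \<AA> V n"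
  by (induction k arbitrary: T)
    (simp_all add: pow_op_Suc_right compose_assoc height_ops_lower del: height_ops.simps)

end

locale unitary_dilation = compression_invariant \<AA> V
  for \<AA> :: "('a::complex_hilbert \<Rightarrow>\<^sub>L 'a) set" and V +
  fixes U :: "'b::complex_hilbert \<Rightarrow>\<^sub>L 'b" and Z :: "'a \<Rightarrow>\<^sub>L 'b"
  assumes iso: "isometry_op Z"
    and unitary: "unitary_op U"
    and intertwine: "U o\<^sub>L Z = Z o\<^sub>L V"
begin

lemma Z_bounded: "Z \<in> bounded_ops"
  using iso by (simp add: isometry_op_def)

lemma U_bounded: "U \<in> bounded_ops" and U_adj_U: "U\<^sup>\<dagger> o\<^sub>L U = id_blinfun"
  and U_U_adj: "U o\<^sub>L U\<^sup>\<dagger> = id_blinfun"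
  using unitary by (simp_all add: unitary_op_def)

lemma Z_adj_Z_compose: "Z\<^sup>\<dagger> o\<^sub>L (Z o\<^sub>L T) = T"
  by (simp add: isometry_adj_compose[OF iso] flip: compose_assoc)

lemma pow_intertwine: "pow_op U j o\<^sub>L Z = Z o\<^sub>L pow_op V j"
proof (induction j)
  case (Suc j)
  then show ?case by (simp add: pow_op_Suc compose_assoc compose_eq_assoc[OF intertwine])
qed simp

lemma pow_adj_intertwine: "Z\<^sup>\<dagger> o\<^sub>L pow_op (U\<^sup>\<dagger>) k = pow_op (V\<^sup>\<dagger>) k o\<^sub>L Z\<^sup>\<dagger>"
proof (induction k)
  case (Suc k)
  have *: "Z\<^sup>\<dagger> o\<^sub>L U\<^sup>\<dagger> = V\<^sup>\<dagger> o\<^sub>L Z\<^sup>\<dagger>"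
    using adj_op_compose[OF U_bounded Z_bounded] adj_op_compose[OF Z_bounded V_bounded] intertwine
    by simp
  then show ?case by (simp add: Suc pow_op_Suc compose_assoc compose_eq_assoc[OF *])
qed simp

text \<open>
  The inner factor \<open>U U\<^sup>\<dagger> = 1\<close> cancels; iterating this reduces \<open>U\<^sup>j U\<^sup>\<dagger>\<^sup>k\<close> to a pure power of \<open>U\<close> or of
  \<open>U\<^sup>\<dagger>\<close>.
\<close>

lemma pow_cancel:
  "pow_op U (Suc j) o\<^sub>L pow_op (U\<^sup>\<dagger>) (Suc k) = pow_op U j o\<^sub>L pow_op (U\<^sup>\<dagger>) k"
  unfolding pow_op_Suc_right[of U j] pow_op_Suc[of "U\<^sup>\<dagger>" k]
  by (simp add: compose_assoc compose_eq_assoc[OF U_U_adj])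

text \<open>
  The compression of \<open>U\<^sup>j U\<^sup>\<dagger>\<^sup>k\<close> to the image of \<open>Z\<close> is a power of \<open>V\<close> or of \<open>V\<^sup>\<dagger>\<close>, which changes
  the height by \<open>j - k\<close>. The offset \<open>n\<close> carries the induction: cancelling a factor \<open>U U\<^sup>\<dagger>\<close> lowers
  \<open>j\<close> and \<open>k\<close> by one and raises \<open>n\<close> by one.
\<close>

lemma compression_height:
  "T \<in> height_ops \<AA> V (n + k) \<Longrightarrow>
    Z\<^sup>\<dagger> o\<^sub>L (pow_op U j o\<^sub>L (pow_op (U\<^sup>\<dagger>) k o\<^sub>L (Z o\<^sub>L T))) \<in> height_ops \<AA> V (n + j)"
proof (induction j arbitrary: k n)
  case 0
  have "Z\<^sup>\<dagger> o\<^sub>L (pow_op (U\<^sup>\<dagger>) k o\<^sub>L (Z o\<^sub>L T)) = pow_op (V\<^sup>\<dagger>) k o\<^sub>L T"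
    by (simp add: compose_eq_assoc[OF pow_adj_intertwine] compose_assoc Z_adj_Z_compose)
  then show ?case using height_ops_lower_pow[OF 0] by simp
next
  case (Suc j)
  show ?case
  proof (cases k)
    case 0
    have "pow_op U (Suc j) o\<^sub>L (Z o\<^sub>L T) = Z o\<^sub>L (pow_op V (Suc j) o\<^sub>L T)"
      by (simp only: compose_eq_assoc[OF pow_intertwine] compose_assoc)
    then show ?thesis
      using height_ops_raise_pow[of T n "Suc j"] Suc.prems 0
      by (simp add: Z_adj_Z_compose del: height_ops.simps)
  next
    case (Suc k')
    have "pow_op U (Suc j) o\<^sub>L (pow_op (U\<^sup>\<dagger>) k o\<^sub>L (Z o\<^sub>L T))
        = pow_op U j o\<^sub>L (pow_op (U\<^sup>\<dagger>) k' o\<^sub>L (Z o\<^sub>L T))"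
      unfolding Suc by (simp only: compose_eq_assoc[OF pow_cancel] compose_assoc)
    then show ?thesis
      using Suc.IH[of "Suc n" k'] Suc.prems by (simp add: Suc del: height_ops.simps)
  qed
qed

abbreviation "hat_module \<equiv> dilation_module \<AA> V U Z"

lemma module_iff:
  "Y \<in> hat_module k \<longleftrightarrow>
    (\<forall>j. Z\<^sup>\<dagger> o\<^sub>L (pow_op U j o\<^sub>L (pow_op (U\<^sup>\<dagger>) k o\<^sub>L Y)) \<in> height_ops \<AA> V j)"
  by (simp add: dilation_module_def compose_assoc)

lemma module_closed_op_subspace: "closed_op_subspace (hat_module k)"
  unfolding dilation_module_def
  by (intro closed_op_subspace_Inter closed_op_subspace_compose_vimage
      height_ops_closed_op_subspace compose_bounded_ops adj_op_bounded_ops pow_bounded_ops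
      Z_bounded U_bounded)

lemma Z_height_in_module: "T \<in> height_ops \<AA> V k \<Longrightarrow> Z o\<^sub>L T \<in> hat_module k"
  using compression_height[of T 0 k] by (simp add: module_iff)

lemma module_height: "Y \<in> hat_module k \<Longrightarrow> Z\<^sup>\<dagger> o\<^sub>L Y \<in> height_ops \<AA> V k"
proof -
  have *: "pow_op U k o\<^sub>L pow_op (U\<^sup>\<dagger>) k = id_blinfun"
  proof (induction k)
    case (Suc k)
    then show ?case by (simp only: pow_cancel)
  qed simp
  have "pow_op U k o\<^sub>L (pow_op (U\<^sup>\<dagger>) k o\<^sub>L Y) = Y"
    by (simp add: compose_eq_assoc[OF *])
  moreover assume "Y \<in> hat_module k"
  then have "Z\<^sup>\<dagger> o\<^sub>L (pow_op U k o\<^sub>L (pow_op (U\<^sup>\<dagger>) k o\<^sub>L Y)) \<in> height_ops \<AA> V k"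
    by (simp add: module_iff)
  ultimately show ?thesis by simp
qed

text \<open>
  \<open>U\<^sup>\<dagger> U = 1\<close> cancels one of the \<open>k + 1\<close> factors \<open>U\<^sup>\<dagger>\<close>. Read from right to left, this is the
  shift by \<open>U\<close>; read from left to right, it lets \<open>U\<^sup>\<dagger>\<close> undo the shift.
\<close>

lemma U_module: "U o\<^sub>L Y \<in> hat_module (Suc k) \<longleftrightarrow> Y \<in> hat_module k"
proof -
  have "pow_op (U\<^sup>\<dagger>) (Suc k) o\<^sub>L (U o\<^sub>L Y) = pow_op (U\<^sup>\<dagger>) k o\<^sub>L Y"
    by (simp add: pow_op_Suc_right compose_assoc compose_eq_assoc[OF U_adj_U])
  then show ?thesis by (simp add: module_iff)
qed

text \<open>
  The factors act one after the other: \<open>Z\<^sup>\<dagger>\<close> leads from the module to operators of height \<open>k\<close>,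
  \<open>A\<close> preserves the height, and \<open>Z\<close> leads back.
\<close>

lemma embedded_alg_in_stabilizer:
  assumes "A \<in> \<AA>"
  shows "Z o\<^sub>L A o\<^sub>L Z\<^sup>\<dagger> \<in> stabilizer hat_module"
proof -
  have *: "Z o\<^sub>L B o\<^sub>L Z\<^sup>\<dagger> o\<^sub>L Y \<in> hat_module k" if "B \<in> \<AA>" "Y \<in> hat_module k" for B Y k
    using Z_height_in_module[OF height_ops_alg[OF that(1) module_height[OF that(2)]]]
    by (simp add: compose_assoc)
  have "(Z o\<^sub>L A o\<^sub>L Z\<^sup>\<dagger>)\<^sup>\<dagger> = Z o\<^sub>L A\<^sup>\<dagger> o\<^sub>L Z\<^sup>\<dagger>"
    using Z_bounded alg_bounded[OF assms]
    by (simp add: adj_op_compose compose_bounded_ops adj_op_bounded_ops adj_op_adj_op compose_assoc)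
  then show ?thesis
    using * assms alg_adj Z_bounded alg_bounded
    by (simp add: stabilizer_def compose_bounded_ops adj_op_bounded_ops)
qed

text \<open>
  The stabiliser property is applied to the element \<open>Z\<close> of the module at \<open>k = 0\<close>, which
  \<open>Z\<^sup>\<dagger>\<close> maps to height \<open>0\<close>, that is, into \<open>\<AA>\<close>.
\<close>

lemma stabilizer_compression:
  assumes "X \<in> stabilizer hat_module"
  shows "Z\<^sup>\<dagger> o\<^sub>L X o\<^sub>L Z \<in> \<AA>"
proof -
  have "Z \<in> hat_module 0" using Z_height_in_module[of id_blinfun 0] alg_id by simp
  then have "X o\<^sub>L Z \<in> hat_module 0" using assms by (simp add: stabilizer_def)
  from module_height[OF this] show ?thesis by (simp add: compose_assoc)
qed

text \<open>
  \<open>U\<close> leads from level \<open>k\<close> to level \<open>k + 1\<close>, which \<open>X\<close> preserves, and \<open>U\<^sup>\<dagger>\<close> leads back. Stabilising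
  the whole sequence of modules, and not only the first, is what makes this work.
\<close>

lemma stabilizer_conjugation:
  assumes "X \<in> stabilizer hat_module"
  shows "U\<^sup>\<dagger> o\<^sub>L X o\<^sub>L U \<in> stabilizer hat_module"
proof -
  have Xb: "X \<in> bounded_ops" using assms by (simp add: stabilizer_def)
  have *: "U\<^sup>\<dagger> o\<^sub>L W o\<^sub>L U o\<^sub>L Y \<in> hat_module k"
    if "\<And>k Y. Y \<in> hat_module k \<Longrightarrow> W o\<^sub>L Y \<in> hat_module k" "Y \<in> hat_module k" for W Y k
  proof -
    have "W o\<^sub>L (U o\<^sub>L Y) \<in> hat_module (Suc k)" using that by (simp add: U_module)
    moreover have "W o\<^sub>L (U o\<^sub>L Y) = U o\<^sub>L (U\<^sup>\<dagger> o\<^sub>L W o\<^sub>L U o\<^sub>L Y)"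
      by (simp add: compose_assoc compose_eq_assoc[OF U_U_adj])
    ultimately show ?thesis by (simp add: U_module)
  qed
  have "(U\<^sup>\<dagger> o\<^sub>L X o\<^sub>L U)\<^sup>\<dagger> = U\<^sup>\<dagger> o\<^sub>L X\<^sup>\<dagger> o\<^sub>L U"
    using U_bounded Xb
    by (simp add: adj_op_compose compose_bounded_ops adj_op_bounded_ops adj_op_adj_op compose_assoc)
  then show ?thesis
    using * assms U_bounded Xb
    by (simp add: stabilizer_def compose_bounded_ops adj_op_bounded_ops)
qed

end

theorem proposition1:
  fixes \<AA> :: "('a::complex_hilbert \<Rightarrow>\<^sub>L 'a) set"
    and V :: "'a \<Rightarrow>\<^sub>L 'a"
    and V_hat :: "'b::complex_hilbert \<Rightarrow>\<^sub>L 'b"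
    and Z :: "'a \<Rightarrow>\<^sub>L 'b"
  assumes "unital_cstar_algebra \<AA>"
    and "isometry_op V"
    and "(\<lambda>A. V\<^sup>\<dagger> o\<^sub>L A o\<^sub>L V) ` \<AA> \<subseteq> \<AA>"
    and "minimal_unitary_dilation V V_hat Z"
  shows "\<exists>\<AA>_hat :: ('b \<Rightarrow>\<^sub>L 'b) set. unital_cstar_algebra \<AA>_hat \<and>
    (\<lambda>A. Z o\<^sub>L A o\<^sub>L Z\<^sup>\<dagger>) ` \<AA> \<subseteq> \<AA>_hat \<and>
    (\<lambda>X. Z\<^sup>\<dagger> o\<^sub>L X o\<^sub>L Z) ` \<AA>_hat \<subseteq> \<AA> \<and>
    (\<lambda>X. V_hat\<^sup>\<dagger> o\<^sub>L X o\<^sub>L V_hat) ` \<AA>_hat \<subseteq> \<AA>_hat \<and>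
    (\<forall>X\<in>\<AA>_hat. Z\<^sup>\<dagger> o\<^sub>L V_hat\<^sup>\<dagger> o\<^sub>L X o\<^sub>L V_hat o\<^sub>L Z =
      V\<^sup>\<dagger> o\<^sub>L Z\<^sup>\<dagger> o\<^sub>L X o\<^sub>L Z o\<^sub>L V) \<and>
    (\<forall>A\<in>\<AA>. Z\<^sup>\<dagger> o\<^sub>L V_hat\<^sup>\<dagger> o\<^sub>L (Z o\<^sub>L A o\<^sub>L Z\<^sup>\<dagger>) o\<^sub>L V_hat o\<^sub>L Z =
      V\<^sup>\<dagger> o\<^sub>L A o\<^sub>L V)"
proof -
  have pow: "pow_op V_hat n o\<^sub>L Z = Z o\<^sub>L pow_op V n" for n
    using assms(4) by (simp add: minimal_unitary_dilation_def)
  interpret unitary_dilation \<AA> V V_hat Z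
  proof
    show "V_hat o\<^sub>L Z = Z o\<^sub>L V"
      using pow[of "Suc 0"] by (simp add: pow_op_Suc)
  qed (use assms in \<open>auto simp: isometry_op_def minimal_unitary_dilation_def\<close>)
  have adj: "Z\<^sup>\<dagger> o\<^sub>L V_hat\<^sup>\<dagger> = V\<^sup>\<dagger> o\<^sub>L Z\<^sup>\<dagger>"
    using pow_adj_intertwine[of "Suc 0"] by (simp add: pow_op_Suc)
  have compression: "Z\<^sup>\<dagger> o\<^sub>L V_hat\<^sup>\<dagger> o\<^sub>L X o\<^sub>L V_hat o\<^sub>L Z = V\<^sup>\<dagger> o\<^sub>L Z\<^sup>\<dagger> o\<^sub>L X o\<^sub>L Z o\<^sub>L V" for X
    unfolding adj by (simp add: compose_assoc intertwine)
  moreover have "V\<^sup>\<dagger> o\<^sub>L Z\<^sup>\<dagger> o\<^sub>L (Z o\<^sub>L A o\<^sub>L Z\<^sup>\<dagger>) o\<^sub>L Z o\<^sub>L V = V\<^sup>\<dagger> o\<^sub>L A o\<^sub>L V" for A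
    by (simp add: compose_assoc Z_adj_Z_compose)
  ultimately show ?thesis
    using stabilizer_unital_cstar_algebra[OF module_closed_op_subspace] embedded_alg_in_stabilizer
      stabilizer_compression stabilizer_conjugation
    by (intro exI[of _ "stabilizer hat_module"]) auto
qed

end
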